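(* Let $H\in\mathbb{C}^{M\times M}$ be Hermitian, let $V\in\mathbb{C}^{M\times m}$ be a fixed (time-independent) matrix of full column rank, and put $S=V^\dagger V$, $H_K=V^\dagger HV$. If $c:[0,T]\to\mathbb{C}^m$ solves the projected equation $$iS\dot c=H_Kc ,$$ then the Gram norm is preserved: $$\frac{d}{dt}\bigl(c^\dagger Sc\bigr)=0 .$$ If moreover the columns of $V$ are orthonormal, then $S=I$ and the projected equation reduces to the ordinary Schr\"odinger evolution $i\dot c=H_Kc$ on $\mathbb{C}^m$ generated by the Hermitian matrix $H_K$.
   Context: $\dagger$ denotes the conjugate transpose and the dot the time derivative. *)

theory Defs
  imports "HOL-Analysis.Analysis"
begin

text \<open>A matrix with \<open>r\<close> rows and \<open>s\<close> columns has type \<open>complex^'s^'r\<close>: the outer index is the row.\<close>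

definition conj_transpose :: "complex^'s^'r \<Rightarrow> complex^'r^'s"  ("_\<^sup>\<dagger>" [1000] 1000)
  where "A\<^sup>\<dagger> = map_matrix cnj (transpose A)"

definition hermitian :: "complex^'r^'r \<Rightarrow> bool"
  where "hermitian A \<longleftrightarrow> A\<^sup>\<dagger> = A"

text \<open>The complex number \<open>x\<^sup>\<dagger> y\<close>, conjugate-linear in \<open>x\<close>. The library's \<open>inner\<close> on
  \<open>complex^'r\<close> is only its real part.\<close>

definition cinner :: "complex^'r \<Rightarrow> complex^'r \<Rightarrow> complex"
  where "cinner x y = (\<Sum>k\<in>UNIV. cnj (x $ k) * y $ k)"

definition orthonormal_columns :: "complex^'s^'r \<Rightarrow> bool"
  where "orthonormal_columns V \<longleftrightarrow>
    (\<forall>j k. cinner (column j V) (column k V) = (if j = k then 1 else 0))"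

text \<open>Solutions on \<open>[0,T]\<close> are differentiable at every point of the closed interval, with one-sided
  derivatives at the end points; no continuity of the derivative is required.\<close>

definition solves_projected ::
    "complex^'s^'s \<Rightarrow> complex^'s^'s \<Rightarrow> real \<Rightarrow> (real \<Rightarrow> complex^'s) \<Rightarrow> bool"
  where "solves_projected S K T c \<longleftrightarrow>
    (\<forall>t\<in>{0..T}. \<exists>c'. (c has_vector_derivative c') (at t within {0..T}) \<and>
       \<i> *s (S *v c') = K *v c t)"

definition solves_schroedinger ::
    "complex^'s^'s \<Rightarrow> real \<Rightarrow> (real \<Rightarrow> complex^'s) \<Rightarrow> bool"
  where "solves_schroedinger K T c \<longleftrightarrow>
    (\<forall>t\<in>{0..T}. \<exists>c'. (c has_vector_derivative c') (at t within {0..T}) \<and>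
       \<i> *s c' = K *v c t)"

end

theory Submission
  imports Defs
begin

text \<open>Both terms of the product rule for \<open>c\<^sup>\<dagger> S c\<close> are expressed through \<open>S c'\<close>, using that \<open>S\<close>
  is Hermitian. Substituting \<open>S c' = - \<i> H\<^sub>K c\<close> then leaves \<open>\<plusminus> \<i> c\<^sup>\<dagger> H\<^sub>K c\<close>, which cancel because
  \<open>H\<^sub>K\<close> is Hermitian. In particular \<open>S\<close> is never inverted.\<close>

lemma conj_transpose_nth [simp]: "A\<^sup>\<dagger> $ i $ j = cnj (A $ j $ i)"
  by (simp add: conj_transpose_def transpose_def map_matrix_def)

lemma conj_transpose_conj_transpose [simp]: "(A\<^sup>\<dagger>)\<^sup>\<dagger> = A"
  by (simp add: vec_eq_iff)

lemma conj_transpose_matrix_mult: "(A ** B)\<^sup>\<dagger> = B\<^sup>\<dagger> ** A\<^sup>\<dagger>"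
  by (simp add: vec_eq_iff matrix_matrix_mult_def mult.commute)

lemma hermitian_conj_transpose_mult_self: "hermitian (V\<^sup>\<dagger> ** V)"
  by (simp add: hermitian_def conj_transpose_matrix_mult)

lemma hermitian_congruence: "hermitian H \<Longrightarrow> hermitian (V\<^sup>\<dagger> ** H ** V)"
  by (simp add: hermitian_def conj_transpose_matrix_mult matrix_mul_assoc)

text \<open>Exchanging the two finite sums moves \<open>A\<close> to the other slot as its adjoint;
  for a Hermitian \<open>A\<close> this is self-adjointness.\<close>

lemma cinner_matrix_vector_mult: "cinner x (A *v y) = cinner (A\<^sup>\<dagger> *v x) y"
proof -
  have "cinner x (A *v y) = (\<Sum>k\<in>UNIV. \<Sum>j\<in>UNIV. cnj (x $ k) * (A $ k $ j * y $ j))"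
    by (simp add: cinner_def matrix_vector_mult_def sum_distrib_left)
  also have "\<dots> = (\<Sum>j\<in>UNIV. \<Sum>k\<in>UNIV. cnj (x $ k) * (A $ k $ j * y $ j))"
    by (rule sum.swap)
  also have "\<dots> = cinner (A\<^sup>\<dagger> *v x) y"
    by (simp add: cinner_def matrix_vector_mult_def sum_distrib_left sum_distrib_right mult_ac)
  finally show ?thesis .
qed

lemma cinner_scale_left: "cinner (a *s x) y = cnj a * cinner x y"
  by (simp add: cinner_def sum_distrib_left mult_ac)

lemma cinner_scale_right: "cinner x (a *s y) = a * cinner x y"
  by (simp add: cinner_def sum_distrib_left mult_ac)

text \<open>Conjugate-linearity in \<open>x\<close> is still linearity over the reals, and
  boundedness is automatic in finite dimension. This makes the product rule for a real time variable
  available.\<close>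

lemma bounded_bilinear_sesquilinear_form: "bounded_bilinear (\<lambda>x y. cinner x (A *v y))"
  unfolding bilinear_conv_bounded_bilinear [symmetric] bilinear_def
  by (auto intro!: linearI
      simp: cinner_def matrix_vector_mult_def algebra_simps sum.distrib sum_distrib_left
        scaleR_conv_of_real [where 'a = complex])

text \<open>The entries of the Gram matrix are the products \<open>cinner\<close> of pairs of
  columns.\<close>

lemma orthonormal_columns_iff: "orthonormal_columns V \<longleftrightarrow> V\<^sup>\<dagger> ** V = mat 1"
  by (auto simp: orthonormal_columns_def vec_eq_iff matrix_matrix_mult_def mat_def cinner_def
      column_def)

lemma solves_projected_mat_1: "solves_projected (mat 1) K T c \<longleftrightarrow> solves_schroedinger K T c"
  by (simp add: solves_projected_def solves_schroedinger_def)

lemma gram_norm_preserved: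
  assumes "hermitian S" and "hermitian K" and "solves_projected S K T c" and "t \<in> {0..T}"
  shows "((\<lambda>s. cinner (c s) (S *v c s)) has_vector_derivative 0) (at t within {0..T})"
proof -
  obtain c' where deriv: "(c has_vector_derivative c') (at t within {0..T})"
    and eq: "\<i> *s (S *v c') = K *v c t"
    using assms(3,4) unfolding solves_projected_def by blast
  have "S *v c' = (- \<i>) *s (\<i> *s (S *v c'))"
    by (simp add: vec_eq_iff)
  then have Sc': "S *v c' = (- \<i>) *s (K *v c t)"
    by (simp only: eq)
  have "cinner c' (S *v c t) = cinner (S *v c') (c t)"
    using assms(1) by (simp add: cinner_matrix_vector_mult hermitian_def)
  \<comment> \<open>The sign flips because the factor \<open>- \<i>\<close> leaves the first slot
    conjugated.\<close>
  also have "\<dots> = \<i> * cinner (K *v c t) (c t)"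
    unfolding Sc' cinner_scale_left by simp
  also have "\<dots> = \<i> * cinner (c t) (K *v c t)"
    using assms(2) by (simp add: cinner_matrix_vector_mult hermitian_def)
  \<comment> \<open>The left side is the derivative exactly as the product rule delivers it.\<close>
  finally have "cinner (c t) (S *v c') + cinner c' (S *v c t) = 0"
    unfolding Sc' cinner_scale_right by simp
  then show ?thesis
    using bounded_bilinear.has_vector_derivative
        [OF bounded_bilinear_sesquilinear_form [of S] deriv deriv] by simp
qed

theorem corollary1:
  fixes H :: "complex^'M^'M" and V :: "complex^'m^'M"
    and S H\<^sub>K :: "complex^'m^'m" and T :: real
  assumes "hermitian H"
    and "rank V = CARD('m)"
    and "S = V\<^sup>\<dagger> ** V"
    and "H\<^sub>K = V\<^sup>\<dagger> ** H ** V"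
    and "0 < T"
  shows "(\<forall>c. solves_projected S H\<^sub>K T c \<longrightarrow>
           (\<forall>t\<in>{0..T}. ((\<lambda>s. cinner (c s) (S *v c s)) has_vector_derivative 0) (at t within {0..T})))
       \<and> (orthonormal_columns V \<longrightarrow>
           S = mat 1 \<and> hermitian H\<^sub>K \<and>
           (\<forall>c. solves_projected S H\<^sub>K T c \<longleftrightarrow> solves_schroedinger H\<^sub>K T c))"
  \<comment> \<open>Both \<open>S\<close> and \<open>H\<^sub>K\<close> are Hermitian by
    construction; orthonormality turns \<open>S\<close> into \<open>mat 1\<close>, where the two
    equations coincide.\<close>
  using gram_norm_preserved hermitian_conj_transpose_mult_self hermitian_congruence
    orthonormal_columns_iff solves_projected_mat_1 assms(1,3,4)
  by metis

end
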